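(* For each $p\in\{7,8\}$, there exists a $p$-atomic positive measure $\mu$ supported in $\mathbb{R}_+$ such that $\mu*t\mu$ has a positive square root measure, but $\mu$ has no positive square root.
   Context: $\mathbb{R}_+=[0,+\infty)$. A positive measure is $p$-atomic if it is of the form $\sum_{k=1}^p a_k\delta_{x_k}$ with $x_1,\dots,x_p$ distinct and all $a_k>0$. The multiplicative convolution of two finite measures is $[\nu*\mu](E)=\int\int\chi_E(xy)\,d\nu(x)\,d\mu(y)$, so $\delta_a*\delta_b=\delta_{ab}$. $t\mu$ denotes the measure with $d(t\mu)(t)=t\,d\mu(t)$. A positive square root of a measure $\eta$ is a finite positive measure $\nu$ supported in $\mathbb{R}_+$ with $\nu*\nu=\eta$. *)

theory Defs
  imports "HOL-Probability.Probability"
begin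

text \<open>Measures are Borel measures on the real line (\<open>sets \<mu> = sets borel\<close>), hence positive.
  Since \<open>[0, \<infinity>)\<close> is closed, the support of such a measure is contained in it
  iff its complement is a null set.\<close>

definition supported_nonneg :: "real measure \<Rightarrow> bool" where
  "supported_nonneg \<mu> \<longleftrightarrow> sets \<mu> = sets borel \<and> emeasure \<mu> (- {0..}) = 0"

definition atomic_measure :: "nat \<Rightarrow> real measure \<Rightarrow> bool" where
  "atomic_measure p \<mu> \<longleftrightarrow> sets \<mu> = sets borel \<and>
     (\<exists>a x :: nat \<Rightarrow> real. inj_on x {1..p} \<and> (\<forall>k\<in>{1..p}. a k > 0) \<and>
        (\<forall>E\<in>sets borel. emeasure \<mu> E = (\<Sum>k=1..p. ennreal (a k) * emeasure (return borel (x k)) E)))"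

definition mult_convolution :: "real measure \<Rightarrow> real measure \<Rightarrow> real measure" (infixl "\<star>\<^sub>m" 70) where
  "\<nu> \<star>\<^sub>m \<mu> = measure_of UNIV (sets borel)
     (\<lambda>E. \<integral>\<^sup>+ y. (\<integral>\<^sup>+ x. indicator E (x * y) \<partial>\<nu>) \<partial>\<mu>)"

text \<open>The coercion \<open>ennreal\<close> truncates negative numbers to 0, so this is \<open>t d\<mu>(t)\<close>
  only for measures supported in \<open>[0, \<infinity>)\<close>.\<close>

definition t_times :: "real measure \<Rightarrow> real measure" where
  "t_times \<mu> = density \<mu> (\<lambda>t. ennreal t)"

definition positive_square_root :: "real measure \<Rightarrow> real measure \<Rightarrow> bool" where
  "positive_square_root \<eta> \<nu> \<longleftrightarrow> finite_measure \<nu> \<and> supported_nonneg \<nu> \<and> \<nu> \<star>\<^sub>m \<nu> = \<eta>"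

lemma mult_convolution_eq_distr:
  assumes "finite_measure \<nu>" "finite_measure \<mu>" and [measurable_cong]: "sets \<nu> = sets borel" "sets \<mu> = sets borel"
  shows "\<nu> \<star>\<^sub>m \<mu> = distr (\<nu> \<Otimes>\<^sub>M \<mu>) borel (\<lambda>(x, y). x * y)"
proof -
  interpret N: finite_measure \<nu> by fact
  interpret M: finite_measure \<mu> by fact
  interpret P: pair_sigma_finite \<nu> \<mu> ..
  let ?D = "distr (\<nu> \<Otimes>\<^sub>M \<mu>) borel (\<lambda>(x, y). x * y)"
  have "emeasure ?D E = (\<integral>\<^sup>+ y. (\<integral>\<^sup>+ x. indicator E (x * y) \<partial>\<nu>) \<partial>\<mu>)" if [measurable]: "E \<in> sets borel" for E
  proof -
    have "emeasure ?D E = (\<integral>\<^sup>+ z. indicator E z \<partial>?D)"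
      by simp
    also have "\<dots> = (\<integral>\<^sup>+ z. indicator E (fst z * snd z) \<partial>(\<nu> \<Otimes>\<^sub>M \<mu>))"
      by (subst nn_integral_distr) (auto simp: case_prod_beta)
    also have "\<dots> = (\<integral>\<^sup>+ y. (\<integral>\<^sup>+ x. indicator E (x * y) \<partial>\<nu>) \<partial>\<mu>)"
      by (subst P.nn_integral_snd[symmetric]) (auto simp: case_prod_beta)
    finally show ?thesis .
  qed
  then have "\<nu> \<star>\<^sub>m \<mu> = measure_of UNIV (sets borel) (emeasure ?D)"
    unfolding mult_convolution_def using sets.sigma_sets_eq[of "borel :: real measure"]
    by (intro measure_of_eq) auto
  also have "\<dots> = ?D"
    using measure_of_of_measure[of ?D] by simp
  finally show ?thesis .
qed

lemma mult_convolution_return: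
  "return borel a \<star>\<^sub>m return borel b = return borel (a * b)"
proof -
  have f: "finite_measure (return borel c)" for c :: real
    by (intro prob_space.finite_measure prob_space_return) simp
  show ?thesis
    unfolding mult_convolution_def
    by (subst measure_of_of_measure[of "return borel (a * b)", symmetric], simp,
        intro measure_of_eq)
       (auto simp: nn_integral_return sets.sigma_sets_eq[of "borel :: real measure", simplified])
qed

end

theory Submission imports Defs begin

text \<open>Encode \<open>\<Sum>\<^sub>n c\<^sub>n \<delta>\<close> with atoms at \<open>2^n\<close> by the polynomial \<open>\<Sum>\<^sub>n c\<^sub>n z^n\<close>: multiplicative
  convolution becomes the product, and \<open>t\<mu>\<close> corresponds to \<open>P(2z)\<close> if \<open>\<mu>\<close> corresponds to \<open>P(z)\<close>.
  Take \<open>P = R^2\<close> with \<open>R = 1 + 2z - z^2 + 2z^3 + z^4\<close>. Then \<open>P\<close> has nonnegative coefficients, exactly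
  seven of them nonzero, and \<open>P(z) P(2z)\<close> is the square of \<open>R(z) R(2z)\<close>, whose coefficients are
  positive. A positive square root \<open>\<nu>\<close> of \<open>\<mu>\<close> would have the same first coefficients as \<open>R\<close>, that is,
  \<open>\<nu>{1} = 1\<close> and \<open>\<nu>{2} = 2\<close>, hence \<open>\<mu>{4} \<ge> \<nu>{2}^2 = 4\<close>, whereas \<open>\<mu>{4} = 2\<close>.
  For \<open>p = 8\<close> add an atom \<open>11\<delta>\<^sub>0\<close> to \<open>\<mu>\<close>; the square root of \<open>\<mu> * t\<mu>\<close> then gains the atom \<open>33\<delta>\<^sub>0\<close>, because
  \<open>33^2 + 2 * 33 * R(1) R(2) = 11 * P(2)\<close>.\<close>

section \<open>Finite sums of point masses\<close>

text \<open>Entries are pairs (weight, location). The point measure lives on list positions, so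
  repeated locations add up and no separate proof of countable additivity is needed.\<close>

definition atoms :: "(real \<times> real) list \<Rightarrow> real measure" where
  "atoms L = distr (point_measure {..<length L} (\<lambda>i. ennreal (fst (L ! i)))) borel (\<lambda>i. snd (L ! i))"

lemma sets_atoms [simp, measurable_cong]: "sets (atoms L) = sets borel"
  by (simp add: atoms_def)

lemma space_atoms [simp]: "space (atoms L) = UNIV"
  by (simp add: atoms_def)

lemma nn_integral_atoms:
  assumes [measurable]: "f \<in> borel_measurable borel"
  shows "(\<integral>\<^sup>+ z. f z \<partial>atoms L) = (\<Sum>(a, x)\<leftarrow>L. ennreal a * f x)"
proof -
  have "(\<integral>\<^sup>+ z. f z \<partial>atoms L) = (\<Sum>i<length L. ennreal (fst (L ! i)) * f (snd (L ! i)))"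
    unfolding atoms_def
    by (subst nn_integral_distr) (auto simp: nn_integral_point_measure_finite)
  then show ?thesis
    by (simp add: sum_list_sum_nth case_prod_beta atLeast0LessThan)
qed

lemma sum_list_ennreal_mult:
  assumes "\<forall>(a, x)\<in>set L. 0 \<le> a" "\<And>x. 0 \<le> g x"
  shows "(\<Sum>(a, x)\<leftarrow>L. ennreal a * ennreal (g x)) = ennreal (\<Sum>(a, x)\<leftarrow>L. a * g x)"
    and "0 \<le> (\<Sum>(a, x)\<leftarrow>L. a * g x)"
proof -
  \<comment> \<open>Both claims go through one induction, since \<open>ennreal_plus\<close> needs
    the tail sum to be nonnegative.\<close>
  have "(\<Sum>(a, x)\<leftarrow>L. ennreal a * ennreal (g x)) = ennreal (\<Sum>(a, x)\<leftarrow>L. a * g x)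
      \<and> 0 \<le> (\<Sum>(a, x)\<leftarrow>L. a * g x)"
    using assms by (induction L) (auto simp: ennreal_mult ennreal_plus)
  then show "(\<Sum>(a, x)\<leftarrow>L. ennreal a * ennreal (g x)) = ennreal (\<Sum>(a, x)\<leftarrow>L. a * g x)"
    and "0 \<le> (\<Sum>(a, x)\<leftarrow>L. a * g x)" by auto
qed

lemma emeasure_atoms:
  assumes "\<forall>(a, x)\<in>set L. 0 \<le> a" and [measurable]: "E \<in> sets borel"
  shows "emeasure (atoms L) E = ennreal (\<Sum>(a, x)\<leftarrow>L. a * indicator E x)"
proof -
  have "emeasure (atoms L) E = (\<integral>\<^sup>+ z. ennreal (indicator E z) \<partial>atoms L)"
    by (simp add: ennreal_indicator)
  then show ?thesis
    using sum_list_ennreal_mult(1)[OF assms(1), of "indicator E"] by (simp add: nn_integral_atoms)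
qed

lemma finite_measure_atoms:
  assumes "\<forall>(a, x)\<in>set L. 0 \<le> a"
  shows "finite_measure (atoms L)"
  by (rule finite_measureI) (simp add: emeasure_atoms[OF assms])

lemma supported_nonneg_atoms:
  assumes "\<forall>(a, x)\<in>set L. 0 \<le> a \<and> 0 \<le> x"
  shows "supported_nonneg (atoms L)"
proof -
  have "(\<Sum>(a, x)\<leftarrow>L. a * indicator (- {0..}) x) = (0::real)"
    using assms by (induction L) auto
  moreover have "- {0..} \<in> sets (borel :: real measure)"
    by measurable
  ultimately show ?thesis
    using assms by (subst supported_nonneg_def, subst emeasure_atoms) auto
qed

lemma atomic_measure_atoms:
  assumes pos: "\<forall>(a, x)\<in>set L. 0 < a" and dist: "distinct (map snd L)"
  shows "atomic_measure (length L) (atoms L)"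
proof -
  \<comment> \<open>Atoms are numbered from 1, list positions from 0.\<close>
  define a x where "a k = fst (L ! (k - 1))" and "x k = snd (L ! (k - 1))" for k
  have "inj_on x {1..length L}"
    using dist unfolding inj_on_def x_def distinct_conv_nth
    by (auto; metis Suc_pred diff_le_self le_trans not_less_eq_eq One_nat_def Suc_le_eq)
  moreover have "\<forall>k\<in>{1..length L}. a k > 0"
    using pos unfolding a_def by (auto simp: case_prod_beta)
  moreover have "emeasure (atoms L) E
      = (\<Sum>k=1..length L. ennreal (a k) * emeasure (return borel (x k)) E)"
    if E [measurable]: "E \<in> sets borel" for E
  proof -
    have "emeasure (atoms L) E = (\<integral>\<^sup>+ z. indicator E z \<partial>atoms L)" by simp
    also have "\<dots> = (\<Sum>(a, x)\<leftarrow>L. ennreal a * indicator E x)"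
      by (rule nn_integral_atoms) measurable
    also have "\<dots> = (\<Sum>i<length L. ennreal (a (Suc i)) * emeasure (return borel (x (Suc i))) E)"
      by (simp add: sum_list_sum_nth case_prod_beta atLeast0LessThan a_def x_def E)
    also have "\<dots> = (\<Sum>k=1..length L. ennreal (a k) * emeasure (return borel (x k)) E)"
      by (rule sum.reindex_bij_witness[of _ "\<lambda>k. k - 1" Suc]) auto
    finally show ?thesis .
  qed
  ultimately show ?thesis
    unfolding atomic_measure_def by auto
qed

section \<open>Multiplicative convolution of finite measures and of lists of atoms\<close>

text \<open>A function passed to \<open>measure_of\<close> is the resulting \<open>emeasure\<close>
  only if it is a measure; the representation by \<open>distr\<close> settles this. The product form
  serves to estimate an arbitrary square root, the iterated integral to compute with atoms.\<close>

lemma emeasure_mult_convolution: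
  assumes "finite_measure \<nu>" "finite_measure \<mu>" and [measurable_cong]: "sets \<nu> = sets borel" "sets \<mu> = sets borel"
    and [measurable]: "E \<in> sets borel"
  shows "emeasure (\<nu> \<star>\<^sub>m \<mu>) E = emeasure (\<nu> \<Otimes>\<^sub>M \<mu>) {z. fst z * snd z \<in> E}"
    and "emeasure (\<nu> \<star>\<^sub>m \<mu>) E = (\<integral>\<^sup>+ y. (\<integral>\<^sup>+ x. indicator E (x * y) \<partial>\<nu>) \<partial>\<mu>)"
proof -
  interpret N: finite_measure \<nu> by fact
  interpret M: finite_measure \<mu> by fact
  interpret P: pair_sigma_finite \<nu> \<mu> ..
  have sp: "space \<nu> = UNIV" "space \<mu> = UNIV"
    using sets_eq_imp_space_eq[OF assms(3)] sets_eq_imp_space_eq[OF assms(4)] by auto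
  have 1: "emeasure (\<nu> \<star>\<^sub>m \<mu>) E = emeasure (\<nu> \<Otimes>\<^sub>M \<mu>) {z. fst z * snd z \<in> E}"
    using assms by (subst mult_convolution_eq_distr)
      (auto simp: emeasure_distr space_pair_measure sp case_prod_beta vimage_def)
  show "emeasure (\<nu> \<star>\<^sub>m \<mu>) E = emeasure (\<nu> \<Otimes>\<^sub>M \<mu>) {z. fst z * snd z \<in> E}" by (fact 1)
  have [measurable]: "{z. fst z * snd z \<in> E} \<in> sets (\<nu> \<Otimes>\<^sub>M \<mu>)"
  proof -
    have "{z \<in> space (\<nu> \<Otimes>\<^sub>M \<mu>). fst z * snd z \<in> E} \<in> sets (\<nu> \<Otimes>\<^sub>M \<mu>)" by measurable
    then show ?thesis by (simp add: space_pair_measure sp)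
  qed
  show "emeasure (\<nu> \<star>\<^sub>m \<mu>) E = (\<integral>\<^sup>+ y. (\<integral>\<^sup>+ x. indicator E (x * y) \<partial>\<nu>) \<partial>\<mu>)"
    unfolding 1
    by (subst nn_integral_indicator[symmetric], measurable,
        subst P.nn_integral_snd[symmetric])
      (auto simp: indicator_def of_bool_def)
qed

lemma sets_mult_convolution [simp]: "sets (\<nu> \<star>\<^sub>m \<mu>) = sets borel"
  unfolding mult_convolution_def using sets.sigma_sets_eq[of "borel :: real measure"] by simp

lemma emeasure_mult_convolution_atoms:
  assumes L: "\<forall>(a, x)\<in>set L. 0 \<le> a" and M: "\<forall>(a, x)\<in>set M. 0 \<le> a"
    and E [measurable]: "E \<in> sets borel"
  shows "emeasure (atoms L \<star>\<^sub>m atoms M) E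
    = ennreal (\<Sum>(b, y)\<leftarrow>M. b * (\<Sum>(a, x)\<leftarrow>L. a * indicator E (x * y)))"
proof -
  have inner: "(\<integral>\<^sup>+ x. indicator E (x * y) \<partial>atoms L)
      = ennreal (\<Sum>(a, x)\<leftarrow>L. a * indicator E (x * y))" for y
  proof -
    have "(\<integral>\<^sup>+ x. indicator E (x * y) \<partial>atoms L)
        = (\<Sum>(a, x)\<leftarrow>L. ennreal a * ennreal (indicator E (x * y)))"
      by (subst nn_integral_atoms) (auto simp: ennreal_indicator)
    then show ?thesis
      using sum_list_ennreal_mult(1)[OF L, of "\<lambda>x. indicator E (x * y)"] by simp
  qed
  have 2: "0 \<le> (\<Sum>(a, x)\<leftarrow>L. a * indicator E (x * y))" for y
    using sum_list_ennreal_mult(2)[OF L, of "\<lambda>x. indicator E (x * y)"] by simp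
  \<comment> \<open>An integral depending on the parameter \<open>y\<close> is measurable in
    \<open>y\<close> because \<open>atoms L\<close> is sigma-finite.\<close>
  have meas: "(\<lambda>y. (\<integral>\<^sup>+ x. indicator E (x * y) \<partial>atoms L)) \<in> borel_measurable borel"
  proof -
    interpret finite_measure "atoms L" by (rule finite_measure_atoms[OF L])
    show ?thesis by measurable
  qed
  have "emeasure (atoms L \<star>\<^sub>m atoms M) E = (\<integral>\<^sup>+ y. (\<integral>\<^sup>+ x. indicator E (x * y) \<partial>atoms L) \<partial>atoms M)"
    by (rule emeasure_mult_convolution(2)) (auto simp: finite_measure_atoms L M)
  also have "\<dots> = (\<Sum>(b, y)\<leftarrow>M. ennreal b * ennreal (\<Sum>(a, x)\<leftarrow>L. a * indicator E (x * y)))"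
    by (subst nn_integral_atoms[OF meas]) (simp add: inner)
  also have "\<dots> = ennreal (\<Sum>(b, y)\<leftarrow>M. b * (\<Sum>(a, x)\<leftarrow>L. a * indicator E (x * y)))"
    by (rule sum_list_ennreal_mult(1)[OF M 2])
  finally show ?thesis .
qed

text \<open>An atom at 0 stays in the list with weight 0, which is why the computations with
  \<open>atoms\<close> ask only for nonnegative weights.\<close>

lemma t_times_atoms:
  assumes "\<forall>(a, x)\<in>set L. 0 \<le> a \<and> 0 \<le> x"
  shows "t_times (atoms L) = atoms (map (\<lambda>(a, x). (a * x, x)) L)"
proof (rule measure_eqI)
  fix E assume "E \<in> sets (t_times (atoms L))"
  then have E [measurable]: "E \<in> sets borel" by (simp add: t_times_def)
  have "emeasure (t_times (atoms L)) E = (\<integral>\<^sup>+ t. ennreal t * indicator E t \<partial>atoms L)"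
    unfolding t_times_def by (subst emeasure_density) auto
  also have "\<dots> = (\<Sum>(a, x)\<leftarrow>L. ennreal a * (ennreal x * indicator E x))"
    by (rule nn_integral_atoms) measurable
  also have "\<dots> = (\<Sum>(a, x)\<leftarrow>map (\<lambda>(a, x). (a * x, x)) L. ennreal a * indicator E x)"
    using assms by (induction L) (auto simp: ennreal_mult mult.assoc)
  also have "\<dots> = (\<integral>\<^sup>+ t. indicator E t \<partial>atoms (map (\<lambda>(a, x). (a * x, x)) L))"
    by (rule nn_integral_atoms[symmetric]) measurable
  also have "\<dots> = emeasure (atoms (map (\<lambda>(a, x). (a * x, x)) L)) E"
    by simp
  finally show "emeasure (t_times (atoms L)) E = emeasure (atoms (map (\<lambda>(a, x). (a * x, x)) L)) E" .
qed (simp add: t_times_def)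

section \<open>Obstruction to a positive square root\<close>

text \<open>Here \<open>\<nu>\<close> need not be atomic and may have mass at 0. The gaps of
  \<open>\<mu>\<close> in (0,1) and (1,2) pass to \<open>\<nu>\<close>, so up to null sets 2 factors
  only as 1 * 2 or 2 * 1. This bounds \<open>\<nu>\<close> at 2 from below, and squaring gives the
  bound at 4.\<close>

lemma emeasure_4_ge_if_positive_square_root:
  assumes \<nu>: "positive_square_root \<mu> \<nu>"
    and \<mu>: "emeasure \<mu> {0<..<1} = 0" "emeasure \<mu> {1} = 1" "emeasure \<mu> {1<..<2} = 0" "emeasure \<mu> {2} = 4"
  shows "4 \<le> emeasure \<mu> {4}"
proof -
  have fin: "finite_measure \<nu>" and sets_\<nu> [measurable_cong]: "sets \<nu> = sets borel"
    and neg: "emeasure \<nu> (- {0..}) = 0" and sq: "\<nu> \<star>\<^sub>m \<nu> = \<mu>"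
    using \<nu> by (auto simp: positive_square_root_def supported_nonneg_def)
  interpret finite_measure \<nu> by fact
  have space: "space \<nu> = UNIV"
    using sets_eq_imp_space_eq[OF sets_\<nu>] by simp
  have meas: "{z. fst z * snd z \<in> E} \<in> sets (\<nu> \<Otimes>\<^sub>M \<nu>)" if [measurable]: "E \<in> sets borel" for E
  proof -
    have "{z \<in> Sigma_Algebra.space (\<nu> \<Otimes>\<^sub>M \<nu>). fst z * snd z \<in> E} \<in> sets (\<nu> \<Otimes>\<^sub>M \<nu>)" by measurable
    then show ?thesis by (simp add: space_pair_measure space)
  qed
  have em: "emeasure \<mu> E = emeasure (\<nu> \<Otimes>\<^sub>M \<nu>) {z. fst z * snd z \<in> E}" if "E \<in> sets borel" for E
    unfolding sq[symmetric] using that fin sets_\<nu> by (intro emeasure_mult_convolution(1)) auto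
  \<comment> \<open>The rectangle \<open>A \<times> B\<close> lies in the preimage of
    \<open>E\<close> under multiplication.\<close>
  have lower: "emeasure \<nu> A * emeasure \<nu> B \<le> emeasure \<mu> E"
    if [measurable]: "A \<in> sets borel" "B \<in> sets borel" "E \<in> sets borel"
      and sub: "\<And>x y. x \<in> A \<Longrightarrow> y \<in> B \<Longrightarrow> x * y \<in> E" for A B E
  proof -
    have "emeasure \<nu> A * emeasure \<nu> B = emeasure (\<nu> \<Otimes>\<^sub>M \<nu>) (A \<times> B)"
      by (rule emeasure_pair_measure_Times[symmetric]) (auto simp: sets_\<nu>)
    also have "\<dots> \<le> emeasure (\<nu> \<Otimes>\<^sub>M \<nu>) {z. fst z * snd z \<in> E}"
      by (rule emeasure_mono) (auto simp: sub meas)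
    finally show ?thesis by (simp add: em)
  qed
  \<comment> \<open>Pairs with a coordinate in the null set \<open>N\<close> are negligible, so only
    factorizations avoiding \<open>N\<close> have to be covered by \<open>S\<close>.\<close>
  have upper: "emeasure \<mu> E \<le> emeasure (\<nu> \<Otimes>\<^sub>M \<nu>) S"
    if [measurable]: "E \<in> sets borel" "N \<in> sets borel" and S: "S \<in> sets (\<nu> \<Otimes>\<^sub>M \<nu>)" and N: "emeasure \<nu> N = 0"
      and sub: "\<And>x y. x * y \<in> E \<Longrightarrow> x \<notin> N \<Longrightarrow> y \<notin> N \<Longrightarrow> (x, y) \<in> S" for E N S
  proof -
    have "emeasure \<mu> E = emeasure (\<nu> \<Otimes>\<^sub>M \<nu>) {z. fst z * snd z \<in> E}"
      by (simp add: em)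
    also have "\<dots> \<le> emeasure (\<nu> \<Otimes>\<^sub>M \<nu>) (S \<union> (N \<times> UNIV \<union> UNIV \<times> N))"
    proof (rule emeasure_mono)
      show "{z. fst z * snd z \<in> E} \<subseteq> S \<union> (N \<times> UNIV \<union> UNIV \<times> N)"
        using sub by fastforce
    qed (use S in \<open>auto simp: sets_\<nu>\<close>)
    also have "\<dots> \<le> emeasure (\<nu> \<Otimes>\<^sub>M \<nu>) S + (emeasure (\<nu> \<Otimes>\<^sub>M \<nu>) (N \<times> UNIV) + emeasure (\<nu> \<Otimes>\<^sub>M \<nu>) (UNIV \<times> N))"
      using S by (intro order.trans[OF emeasure_subadditive] add_left_mono emeasure_subadditive) (auto simp: sets_\<nu>)
    also have "emeasure (\<nu> \<Otimes>\<^sub>M \<nu>) (N \<times> UNIV) + emeasure (\<nu> \<Otimes>\<^sub>M \<nu>) (UNIV \<times> N) = 0"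
      using N by (simp add: emeasure_pair_measure_Times sets_\<nu>)
    finally show ?thesis by simp
  qed
  have neg': "emeasure \<nu> {..<0} = 0"
  proof -
    have "{..<0} = - {0::real..}" by auto
    then show ?thesis using neg by simp
  qed
  \<comment> \<open>(0,1) is closed under products, so the square of its mass under
    \<open>\<nu>\<close> is at most 0.\<close>
  have "emeasure \<nu> {0<..<1} * emeasure \<nu> {0<..<1} \<le> emeasure \<mu> {0<..<1}"
  proof (rule lower)
    fix x y :: real assume "x \<in> {0<..<1}" "y \<in> {0<..<1}"
    then show "x * y \<in> {0<..<1}" using mult_strict_mono[of x 1 y 1] by auto
  qed auto
  then have null01: "emeasure \<nu> {0<..<1} = 0"
    using \<mu> by simp
  \<comment> \<open>The point 0 is left out, as \<open>\<nu>\<close> may charge it; a positive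
    product excludes it anyway.\<close>
  define N where "N = {..<0::real} \<union> {0<..<1}"
  have N: "emeasure \<nu> N = 0" "N \<in> sets borel"
    unfolding N_def using null01 neg' by (auto simp: emeasure_Un_null_set null_sets_def sets_\<nu>)
  have ge1: "1 \<le> x \<and> 1 \<le> y" if "x * y > 0" "x \<notin> N" "y \<notin> N" for x y
    using that by (auto simp: N_def not_less)
  have prod_sets: "A \<times> B \<in> sets (\<nu> \<Otimes>\<^sub>M \<nu>)" if "A \<in> sets borel" "B \<in> sets borel" for A B
    using that by (simp add: sets_\<nu>)
  have times: "emeasure (\<nu> \<Otimes>\<^sub>M \<nu>) ({a} \<times> {b}) = emeasure \<nu> {a} * emeasure \<nu> {b}" for a b
    by (rule emeasure_pair_measure_Times) (auto simp: sets_\<nu>)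
  \<comment> \<open>Off \<open>N\<close> both factors of 1 are at least 1, hence equal to 1. This
    makes \<open>\<nu>\<close> charge 1, which is needed to cancel that factor when the gap (1,2) is
    transferred.\<close>
  have "emeasure \<mu> {1} \<le> emeasure (\<nu> \<Otimes>\<^sub>M \<nu>) ({1} \<times> {1})"
  proof (rule upper[OF _ N(2) prod_sets N(1)])
    fix x y assume xy: "x * y \<in> {1}" "x \<notin> N" "y \<notin> N"
    then have "1 \<le> x" "1 \<le> y" using ge1[of x y] by auto
    moreover have "x \<le> 1" "y \<le> 1"
      using xy \<open>1 \<le> x\<close> \<open>1 \<le> y\<close> mult_left_mono[of 1 y x] mult_right_mono[of 1 x y] by auto
    ultimately show "(x, y) \<in> {1} \<times> {1}" using xy by auto
  qed auto
  then have "1 \<le> emeasure \<nu> {1} * emeasure \<nu> {1}"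
    unfolding times \<mu> .
  then have pos: "emeasure \<nu> {1} \<noteq> 0" by auto
  have "emeasure \<nu> {1} * emeasure \<nu> {1} \<le> emeasure \<mu> {1}"
    by (rule lower) auto
  then have le1: "emeasure \<nu> {1} * emeasure \<nu> {1} \<le> 1" using \<mu> by simp
  have "emeasure \<nu> {1} * emeasure \<nu> {1<..<2} \<le> emeasure \<mu> {1<..<2}"
    by (rule lower) auto
  then have "emeasure \<nu> {1<..<2} = 0"
    using \<mu> pos by simp
  define N' where "N' = N \<union> {1<..<2}"
  have N': "emeasure \<nu> N' = 0" "N' \<in> sets borel"
    unfolding N'_def using N \<open>emeasure \<nu> {1<..<2} = 0\<close>
    by (auto simp: emeasure_Un_null_set null_sets_def sets_\<nu>)
  \<comment> \<open>Off \<open>N'\<close> both factors of 2 lie in [1,2] but not in (1,2).\<close>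
  have "emeasure \<mu> {2} \<le> emeasure (\<nu> \<Otimes>\<^sub>M \<nu>) ({1} \<times> {2} \<union> {2} \<times> {1})"
  proof (rule upper[OF _ N'(2) sets.Un[OF prod_sets prod_sets] N'(1)])
    fix x y assume xy: "x * y \<in> {2}" "x \<notin> N'" "y \<notin> N'"
    then have "1 \<le> x" "1 \<le> y" using ge1[of x y] by (auto simp: N'_def)
    moreover have "x \<le> 2" "y \<le> 2"
      using xy \<open>1 \<le> x\<close> \<open>1 \<le> y\<close> mult_left_mono[of 1 y x] mult_right_mono[of 1 x y] by auto
    ultimately have "x = 1 \<or> x = 2" using xy by (auto simp: N'_def)
    then show "(x, y) \<in> {1} \<times> {2} \<union> {2} \<times> {1}" using xy by auto
  qed auto
  also have "\<dots> \<le> emeasure (\<nu> \<Otimes>\<^sub>M \<nu>) ({1} \<times> {2}) + emeasure (\<nu> \<Otimes>\<^sub>M \<nu>) ({2} \<times> {1})"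
    by (intro emeasure_subadditive prod_sets) auto
  also have "\<dots> = 2 * (emeasure \<nu> {1} * emeasure \<nu> {2})"
    unfolding times by (simp add: mult.commute mult_2)
  finally have le4: "4 \<le> 2 * (emeasure \<nu> {1} * emeasure \<nu> {2})"
    using \<mu> by simp
  have "emeasure \<nu> {2} * emeasure \<nu> {2} \<le> emeasure \<mu> {4}"
    by (rule lower) auto
  moreover have "4 \<le> emeasure \<nu> {2} * emeasure \<nu> {2}"
  proof -
    \<comment> \<open>In real numbers, \<open>r \<le> 1\<close> and \<open>2 \<le> r * s\<close>
      give \<open>2 \<le> s\<close>.\<close>
    define r s where "r = measure \<nu> {1}" and "s = measure \<nu> {2}"
    have rs: "0 \<le> r" "0 \<le> s" "emeasure \<nu> {1} = ennreal r" "emeasure \<nu> {2} = ennreal s"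
      by (auto simp: r_def s_def emeasure_eq_measure)
    have "ennreal (r * r) \<le> ennreal 1" "ennreal 4 \<le> ennreal (2 * (r * s))"
      using le1 le4 rs by (simp_all add: ennreal_mult)
    then have "r * r \<le> 1" "2 \<le> r * s"
      using rs by (auto simp: ennreal_le_iff)
    then have "r \<le> 1"
      using rs by (metis abs_of_nonneg abs_square_le_1 power2_eq_square)
    then have "r * s \<le> s"
      using rs by (simp add: mult_left_le_one_le)
    then have "2 * 2 \<le> s * s"
      using \<open>2 \<le> r * s\<close> by (intro mult_mono) auto
    then have "ennreal 4 \<le> ennreal (s * s)" by (intro ennreal_leI) simp
    then show ?thesis using rs by (simp add: ennreal_mult)
  qed
  ultimately show ?thesis by simp
qed

section \<open>The examples with seven and eight atoms\<close>

text \<open>Apart from \<open>Z\<close> and \<open>W\<close>, \<open>L\<close> lists the nonzero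
  coefficients of P(z) and \<open>M\<close> those of R(z) R(2z), with z^n placed at 2^n; 8 and 32
  are missing from \<open>L\<close> because z^3 and z^5 cancel in R^2. The optional atom at 0 is
  carried by \<open>Z\<close> and \<open>W\<close>, so both cases share one proof.\<close>

lemma atoms_R_square_example:
  fixes Z W :: "(real \<times> real) list"
  defines "L \<equiv> [(1, 1), (4, 2), (2, 4), (11, 16), (2, 64), (4, 128), (1, 256)] @ Z"
  defines "M \<equiv> [(1, 1), (6, 2), (3, 4), (6, 8), (61, 16), (12, 32), (12, 64), (48, 128), (16, 256)] @ W"
  assumes ZW: "Z = [] \<and> W = [] \<or> Z = [(11, 0)] \<and> W = [(33, 0)]"
  shows "atomic_measure (length L) (atoms L) \<and> supported_nonneg (atoms L) \<and>
           (\<exists>\<nu>. positive_square_root (atoms L \<star>\<^sub>m t_times (atoms L)) \<nu>) \<and>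
           \<not> (\<exists>\<nu>. positive_square_root (atoms L) \<nu>)"
proof (intro conjI)
  have L: "\<forall>(a, x)\<in>set L. 0 < a" "distinct (map snd L)" "\<forall>(a, x)\<in>set L. 0 \<le> a \<and> 0 \<le> x"
    "\<forall>(a, x)\<in>set L. 0 \<le> a"
    using ZW by (auto simp: L_def)
  have M: "\<forall>(a, x)\<in>set M. 0 \<le> a \<and> 0 \<le> x" "\<forall>(a, x)\<in>set M. 0 \<le> a"
    using ZW by (auto simp: M_def)
  have tL: "\<forall>(a, x)\<in>set (map (\<lambda>(a, x). (a * x, x)) L). 0 \<le> a"
    using L(3) by auto
  show "atomic_measure (length L) (atoms L)" "supported_nonneg (atoms L)"
    using L by (simp_all add: atomic_measure_atoms supported_nonneg_atoms)
  have "atoms M \<star>\<^sub>m atoms M = atoms L \<star>\<^sub>m t_times (atoms L)"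
  proof (rule measure_eqI)
    fix E assume "E \<in> sets (atoms M \<star>\<^sub>m atoms M)"
    then have E: "E \<in> sets borel" by simp
    \<comment> \<open>Expanded, this compares the coefficients of each
      \<open>indicator E (2^n)\<close>, that is, (R(z) R(2z))^2 = P(z) P(2z). With the extra atom,
      \<open>indicator E 0\<close> has coefficient 33^2 + 2 * 33 * 165 on the left and 11 * 1089 on
      the right, where 165 = R(1) R(2) and 1089 = P(2).\<close>
    have "(\<Sum>(b, y)\<leftarrow>M. b * (\<Sum>(a, x)\<leftarrow>M. a * indicator E (x * y)))
      = (\<Sum>(b, y)\<leftarrow>map (\<lambda>(a, x). (a * x, x)) L. b * (\<Sum>(a, x)\<leftarrow>L. a * indicat_real E (x * y)))"
      using ZW by (auto simp: L_def M_def algebra_simps)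
    then show "emeasure (atoms M \<star>\<^sub>m atoms M) E = emeasure (atoms L \<star>\<^sub>m t_times (atoms L)) E"
      by (simp only: t_times_atoms[OF L(3)] emeasure_mult_convolution_atoms[OF M(2) M(2) E]
          emeasure_mult_convolution_atoms[OF L(4) tL E])
  qed simp
  then show "\<exists>\<nu>. positive_square_root (atoms L \<star>\<^sub>m t_times (atoms L)) \<nu>"
    unfolding positive_square_root_def
    using finite_measure_atoms[OF M(2)] supported_nonneg_atoms[OF M(1)] by blast
  \<comment> \<open>None of these sets contains 0, so the values do not depend on \<open>Z\<close>;
    the mass 2 at 4 violates the lower bound 4.\<close>
  have "emeasure (atoms L) {0<..<1} = 0" "emeasure (atoms L) {1} = 1"
    "emeasure (atoms L) {1<..<2} = 0" "emeasure (atoms L) {2} = 4" "emeasure (atoms L) {4} = 2"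
    using ZW by (auto simp: emeasure_atoms[OF L(4)], auto simp: L_def)
  then show "\<not> (\<exists>\<nu>. positive_square_root (atoms L) \<nu>)"
    using emeasure_4_ge_if_positive_square_root[of "atoms L"] by auto
qed

theorem mainTheorem3:
  fixes p :: nat
  assumes "p \<in> {7, 8}"
  shows "\<exists>\<mu> :: real measure. atomic_measure p \<mu> \<and> supported_nonneg \<mu> \<and>
           (\<exists>\<nu>. positive_square_root (\<mu> \<star>\<^sub>m t_times \<mu>) \<nu>) \<and>
           \<not> (\<exists>\<nu>. positive_square_root \<mu> \<nu>)"
proof -
  consider "p = 7" | "p = 8" using assms by auto
  then show ?thesis
  proof cases
    case 1
    then show ?thesis using atoms_R_square_example[of "[]" "[]"]
      by (intro exI) (simp add: numeral_eq_Suc)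
  next
    case 2
    then show ?thesis using atoms_R_square_example[of "[(11, 0)]" "[(33, 0)]"]
      by (intro exI) (simp add: numeral_eq_Suc)
  qed
qed

end
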